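(* For every $\mathsf{LTL}_f$ formula $\phi$, the algorithm $\mathsf{CDLSC}$ run on input $\phi$ terminates, and it returns SAT if $\phi$ is satisfiable and UNSAT if $\phi$ is unsatisfiable.
   Context: $\mathsf{LTL}_f$ is linear temporal logic over finite nonempty traces. $Tail$ holds exactly at the last position of a trace. $\mathrm{xnf}(\psi)$ is the neXt normal form of $\psi$ (equivalent to $\psi$, temporal subformulas only under $\mathsf{X}$); $\mathrm{xnf}(s)=\bigwedge_{\psi\in s}\mathrm{xnf}(\psi)$ for a set $s$ of formulas; $\theta^p$ is the propositional abstraction treating each $\mathsf{X}\chi$ (and $Tail$) as a Boolean variable. States are finite sets of formulas; from a satisfying assignment $A$ of a formula containing $\mathrm{xnf}(s)^p$, the next state is $X(A)=\{\chi:\mathsf{X}\chi \text{ true in } A\}$. A state $s$ is final iff $Tail\wedge\mathrm{xnf}(s)^p$ is satisfiable. The algorithm maintains frames $\mathcal{C}[0],\mathcal{C}[1],\ldots$, each a set of finite sets $c$ of formulas; a state $s$ is "in" $\mathcal{C}[i]$ iff $c\subseteq s$ for some $c\in\mathcal{C}[i]$, and $\neg\mathsf{X}(\mathcal{C}[i])$ denotes $\neg\bigvee_{c\in\mathcal{C}[i]}\bigwedge_{\psi\in c}\mathsf{X}\psi$. $get\_uc()$: after an unsatisfiable SAT query of the form $(\mathrm{xnf}(s)\wedge\theta)^p$, returns a subset $c\subseteq s$ (an unsatisfiable core w.r.t. assumption literals, one per $\psi\in s$) such that $(\bigwedge_{\psi\in c}\mathrm{xnf}(\psi)\wedge\theta)^p$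 is still unsatisfiable. Algorithm $\mathsf{CDLSC}(\phi)$: if $Tail\wedge\mathrm{xnf}(\phi)^p$ is satisfiable, return SAT. Otherwise set $\mathcal{C}[0]:=\{\{\phi\}\}$, $k:=0$, and loop: if $try\_satisfy(\phi,k)$ returns true, return SAT; if $inv\_found(k)$ returns true, return UNSAT; set $k:=k+1$ and $\mathcal{C}[k]:=\emptyset$ (frames not yet created are treated as empty). Procedure $try\_satisfy(\psi_0,\ell)$: while $(\neg\mathsf{X}(\mathcal{C}[\ell])\wedge\mathrm{xnf}(\psi_0))^p$ is satisfiable with model $A$: let $\psi'=X(A)$; if $\ell=0$: if $Tail\wedge\mathrm{xnf}(\psi')^p$ is satisfiable return true, else add $get\_uc()$ to $\mathcal{C}[0]$ and continue the loop; if $\ell>0$ and $try\_satisfy(\psi',\ell-1)$ returns true, return true. After the loop exits, add $get\_uc()$ (from the last unsatisfiable query) to $\mathcal{C}[\ell+1]$ and return false. Procedure $inv\_found(k)$: returns true iff for some frame level $i$ the states in all of $\mathcal{C}[0],\ldots,\mathcal{C}[i]$ are all in $\mathcal{C}[i+1]$ (checked as validity of the Boolean implication $\bigwedge_{j\le i}\mathcal{C}[j]\Rightarrow\mathcal{C}[i+1]$). *)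

theory Defs
  imports Main
begin

section \<open>LTL over finite nonempty traces\<close>

text \<open>
  Besides the primitive operators the syntax contains their duals (weak next \<open>WNext\<close> is dual to the
  strong \<open>Next\<close>), and \<open>Tail\<close>, which marks the last position of the trace.
\<close>

datatype 'a ltlf =
    TT
  | FF
  | Tail
  | Atom 'a
  | Neg "'a ltlf"
  | And "'a ltlf" "'a ltlf"
  | Or "'a ltlf" "'a ltlf"
  | Next "'a ltlf"
  | WNext "'a ltlf"
  | Until "'a ltlf" "'a ltlf"
  | Release "'a ltlf" "'a ltlf"

text \<open>
  A trace is a list of sets of atoms; \<open>holds \<rho> i \<phi>\<close> is meaningful for positions \<open>i < length \<rho>\<close>.
\<close>

primrec holds :: "'a set list \<Rightarrow> nat \<Rightarrow> 'a ltlf \<Rightarrow> bool" where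
  "holds \<rho> i TT \<longleftrightarrow> True"
| "holds \<rho> i FF \<longleftrightarrow> False"
| "holds \<rho> i Tail \<longleftrightarrow> Suc i = length \<rho>"
| "holds \<rho> i (Atom p) \<longleftrightarrow> p \<in> \<rho> ! i"
| "holds \<rho> i (Neg \<phi>) \<longleftrightarrow> \<not> holds \<rho> i \<phi>"
| "holds \<rho> i (And \<phi> \<psi>) \<longleftrightarrow> holds \<rho> i \<phi> \<and> holds \<rho> i \<psi>"
| "holds \<rho> i (Or \<phi> \<psi>) \<longleftrightarrow> holds \<rho> i \<phi> \<or> holds \<rho> i \<psi>"
| "holds \<rho> i (Next \<phi>) \<longleftrightarrow> Suc i < length \<rho> \<and> holds \<rho> (Suc i) \<phi>"
| "holds \<rho> i (WNext \<phi>) \<longleftrightarrow> (Suc i < length \<rho> \<longrightarrow> holds \<rho> (Suc i) \<phi>)"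
| "holds \<rho> i (Until \<phi> \<psi>) \<longleftrightarrow>
     (\<exists>j. i \<le> j \<and> j < length \<rho> \<and> holds \<rho> j \<psi> \<and> (\<forall>m. i \<le> m \<and> m < j \<longrightarrow> holds \<rho> m \<phi>))"
| "holds \<rho> i (Release \<phi> \<psi>) \<longleftrightarrow>
     (\<forall>j. i \<le> j \<and> j < length \<rho> \<longrightarrow> holds \<rho> j \<psi> \<or> (\<exists>m. i \<le> m \<and> m < j \<and> holds \<rho> m \<phi>))"

definition satisfiable :: "'a ltlf \<Rightarrow> bool" where
  "satisfiable \<phi> \<longleftrightarrow> (\<exists>\<rho>. \<rho> \<noteq> [] \<and> holds \<rho> 0 \<phi>)"

text \<open>
  Conjunction and disjunction of a finite set of formulas, in an unspecified order.
\<close>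

definition BigAnd :: "'a ltlf set \<Rightarrow> 'a ltlf" where
  "BigAnd S = foldr And (SOME xs. distinct xs \<and> set xs = S) TT"

definition BigOr :: "'a ltlf set \<Rightarrow> 'a ltlf" where
  "BigOr S = foldr Or (SOME xs. distinct xs \<and> set xs = S) FF"


section \<open>Next normal form\<close>

text \<open>
  Negations are pushed inward on the fly, so that every \<open>Next\<close> outside the scope of another one occurs
  positively. Each \<open>Next\<close> is accompanied by its \<open>Tail\<close> guard: semantically \<open>Next \<psi>\<close> already implies
  \<open>Neg Tail\<close>, but the propositional abstraction sees \<open>Tail\<close> and \<open>Next \<psi>\<close> as unrelated variables.
\<close>

function (sequential) xnf :: "'a ltlf \<Rightarrow> 'a ltlf" where
  "xnf (And \<phi> \<psi>) = And (xnf \<phi>) (xnf \<psi>)"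
| "xnf (Or \<phi> \<psi>) = Or (xnf \<phi>) (xnf \<psi>)"
| "xnf (Next \<phi>) = And (Neg Tail) (Next \<phi>)"
| "xnf (WNext \<phi>) = Or Tail (Next \<phi>)"
| "xnf (Until \<phi> \<psi>) = Or (xnf \<psi>) (And (xnf \<phi>) (And (Neg Tail) (Next (Until \<phi> \<psi>))))"
| "xnf (Release \<phi> \<psi>) = And (xnf \<psi>) (Or (xnf \<phi>) (Or Tail (Next (Release \<phi> \<psi>))))"
| "xnf (Neg TT) = FF"
| "xnf (Neg FF) = TT"
| "xnf (Neg (Neg \<phi>)) = xnf \<phi>"
| "xnf (Neg (And \<phi> \<psi>)) = Or (xnf (Neg \<phi>)) (xnf (Neg \<psi>))"
| "xnf (Neg (Or \<phi> \<psi>)) = And (xnf (Neg \<phi>)) (xnf (Neg \<psi>))"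
| "xnf (Neg (Next \<phi>)) = Or Tail (Next (Neg \<phi>))"
| "xnf (Neg (WNext \<phi>)) = And (Neg Tail) (Next (Neg \<phi>))"
| "xnf (Neg (Until \<phi> \<psi>)) =
     And (xnf (Neg \<psi>)) (Or (xnf (Neg \<phi>)) (Or Tail (Next (Neg (Until \<phi> \<psi>)))))"
| "xnf (Neg (Release \<phi> \<psi>)) =
     Or (xnf (Neg \<psi>)) (And (xnf (Neg \<phi>)) (And (Neg Tail) (Next (Neg (Release \<phi> \<psi>)))))"
| "xnf \<phi> = \<phi>"
  by pat_completeness auto
termination by (relation "measure size") auto

lemma holds_Until_unfold:
  assumes "i < length \<rho>"
  shows "holds \<rho> i (Until \<phi> \<psi>) \<longleftrightarrow>
    holds \<rho> i \<psi> \<or> holds \<rho> i \<phi> \<and> holds \<rho> i (Next (Until \<phi> \<psi>))" (is "?l \<longleftrightarrow> ?r")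
proof
  assume ?l
  then obtain j where j: "i \<le> j" "j < length \<rho>" "holds \<rho> j \<psi>" "\<forall>m. i \<le> m \<and> m < j \<longrightarrow> holds \<rho> m \<phi>"
    by auto
  show ?r
  proof (cases "j = i")
    case False
    with j have "Suc i \<le> j" by simp
    with j show ?thesis by (auto intro!: exI[of _ j])
  qed (use j in simp)
next
  assume ?r
  then show ?l
  proof
    assume "holds \<rho> i \<psi>"
    with assms show ?l by (auto intro!: exI[of _ i])
  next
    assume r: "holds \<rho> i \<phi> \<and> holds \<rho> i (Next (Until \<phi> \<psi>))"
    then obtain j where j: "Suc i \<le> j" "j < length \<rho>" "holds \<rho> j \<psi>"
      "\<forall>m. Suc i \<le> m \<and> m < j \<longrightarrow> holds \<rho> m \<phi>" by auto
    have "holds \<rho> m \<phi>" if "i \<le> m" "m < j" for m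
      using r j that by (cases "m = i") auto
    with j show ?l by (auto intro!: exI[of _ j])
  qed
qed

lemma holds_Release_dual:
  "holds \<rho> i (Release \<phi> \<psi>) \<longleftrightarrow> \<not> holds \<rho> i (Until (Neg \<phi>) (Neg \<psi>))"
  by auto

lemma holds_Release_unfold:
  assumes "i < length \<rho>"
  shows "holds \<rho> i (Release \<phi> \<psi>) \<longleftrightarrow>
    holds \<rho> i \<psi> \<and> (holds \<rho> i \<phi> \<or> holds \<rho> i (WNext (Release \<phi> \<psi>)))"
  using holds_Until_unfold[OF assms, of "Neg \<phi>" "Neg \<psi>"]
  unfolding holds_Release_dual holds.simps(5,8,9) by blast

lemma holds_xnf: "i < length \<rho> \<Longrightarrow> holds \<rho> i (xnf \<phi>) \<longleftrightarrow> holds \<rho> i \<phi>"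
proof (induction \<phi> rule: xnf.induct)
  case (5 \<phi> \<psi>)
  then show ?case
    unfolding holds_Until_unfold[OF 5(3)] by (auto simp del: holds.simps(10))
next
  case (6 \<phi> \<psi>)
  then show ?case
    unfolding holds_Release_unfold[OF 6(3)] by (auto simp del: holds.simps(11))
next
  case (14 \<phi> \<psi>)
  then show ?case
    unfolding holds.simps(5) holds_Until_unfold[OF 14(3)]
    by (auto simp del: holds.simps(10))
next
  case (15 \<phi> \<psi>)
  then show ?case
    unfolding holds.simps(5) holds_Release_unfold[OF 15(3)]
    by (auto simp del: holds.simps(11))
qed auto


section \<open>Propositional abstraction\<close>

datatype 'v pform =
    PTrue
  | PFalse
  | PVar 'v
  | PNot "'v pform"
  | PAnd "'v pform" "'v pform"
  | POr "'v pform" "'v pform"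

primrec pvars :: "'v pform \<Rightarrow> 'v set" where
  "pvars PTrue = {}"
| "pvars PFalse = {}"
| "pvars (PVar v) = {v}"
| "pvars (PNot f) = pvars f"
| "pvars (PAnd f g) = pvars f \<union> pvars g"
| "pvars (POr f g) = pvars f \<union> pvars g"

text \<open>
  An assignment is given by the set of its true variables.
\<close>

primrec peval :: "'v set \<Rightarrow> 'v pform \<Rightarrow> bool" where
  "peval A PTrue \<longleftrightarrow> True"
| "peval A PFalse \<longleftrightarrow> False"
| "peval A (PVar v) \<longleftrightarrow> v \<in> A"
| "peval A (PNot f) \<longleftrightarrow> \<not> peval A f"
| "peval A (PAnd f g) \<longleftrightarrow> peval A f \<and> peval A g"
| "peval A (POr f g) \<longleftrightarrow> peval A f \<or> peval A g"

definition psat :: "'v pform \<Rightarrow> bool" where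
  "psat f \<longleftrightarrow> (\<exists>A. peval A f)"

text \<open>
  The assignments a SAT solver may return assign values to the variables of the query only.
\<close>

definition pmodels :: "'v pform \<Rightarrow> 'v set set" where
  "pmodels f = {A. A \<subseteq> pvars f \<and> peval A f}"

text \<open>
  The variables are the atoms, \<open>Tail\<close>, and the outermost temporal subformulas (for formulas in next
  normal form these are all of the form \<open>Next \<chi>\<close>).
\<close>

primrec pabs :: "'a ltlf \<Rightarrow> 'a ltlf pform" where
  "pabs TT = PTrue"
| "pabs FF = PFalse"
| "pabs Tail = PVar Tail"
| "pabs (Atom p) = PVar (Atom p)"
| "pabs (Neg \<phi>) = PNot (pabs \<phi>)"
| "pabs (And \<phi> \<psi>) = PAnd (pabs \<phi>) (pabs \<psi>)"
| "pabs (Or \<phi> \<psi>) = POr (pabs \<phi>) (pabs \<psi>)"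
| "pabs (Next \<phi>) = PVar (Next \<phi>)"
| "pabs (WNext \<phi>) = PVar (WNext \<phi>)"
| "pabs (Until \<phi> \<psi>) = PVar (Until \<phi> \<psi>)"
| "pabs (Release \<phi> \<psi>) = PVar (Release \<phi> \<psi>)"


section \<open>States and frames\<close>

type_synonym 'a state = "'a ltlf set"
type_synonym 'a frames = "nat \<Rightarrow> 'a state set"

definition xnf_state :: "'a state \<Rightarrow> 'a ltlf" where
  "xnf_state s = BigAnd (xnf ` s)"

definition next_state :: "'a ltlf set \<Rightarrow> 'a state" where
  "next_state A = {\<chi>. Next \<chi> \<in> A}"

definition final :: "'a state \<Rightarrow> bool" where
  "final s \<longleftrightarrow> psat (pabs (And Tail (xnf_state s)))"

definition in_frame :: "'a state \<Rightarrow> 'a state set \<Rightarrow> bool" where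
  "in_frame s F \<longleftrightarrow> (\<exists>c\<in>F. c \<subseteq> s)"

definition not_next_frame :: "'a state set \<Rightarrow> 'a ltlf" where
  "not_next_frame F = Neg (BigOr ((\<lambda>c. BigAnd (Next ` c)) ` F))"

definition step_query :: "'a state set \<Rightarrow> 'a state \<Rightarrow> 'a ltlf pform" where
  "step_query F s = pabs (And (not_next_frame F) (xnf_state s))"

text \<open>
  \<open>unsat_core s \<theta> c\<close>: \<open>get_uc\<close> may answer \<open>c\<close> after the unsatisfiable query for \<open>s\<close> and \<open>\<theta>\<close>.
\<close>

definition unsat_core :: "'a state \<Rightarrow> 'a ltlf \<Rightarrow> 'a state \<Rightarrow> bool" where
  "unsat_core s \<theta> c \<longleftrightarrow> c \<subseteq> s \<and> \<not> psat (pabs (And (xnf_state c) \<theta>))"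

text \<open>
  Quantifying over all finite sets of formulas (not just over reachable states) amounts to validity of
  the Boolean implication whose variables are the formulas occurring in the frames. The level \<open>i\<close> is
  bounded by \<open>k\<close>: beyond that the frames are empty and the inclusion would hold vacuously.
\<close>

definition inv_found :: "'a frames \<Rightarrow> nat \<Rightarrow> bool" where
  "inv_found C k \<longleftrightarrow>
     (\<exists>i\<le>k. \<forall>s. finite s \<longrightarrow> (\<forall>j\<le>i. in_frame s (C j)) \<longrightarrow> in_frame s (C (Suc i)))"


section \<open>The algorithm\<close>

text \<open>
  CDLSC is given as a small-step transition system that is nondeterministic in the models returned by
  the SAT solver and in the unsatisfiable cores returned by \<open>get_uc\<close>. The call stack of \<open>try_satisfy\<close> lists
  the arguments of the active calls, innermost first.

  \<^item> \<open>Start\<close>: before the initial test.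
  \<^item> \<open>Loop st C k\<close>: the innermost call is at the head of its while loop.
  \<^item> \<open>Return b st C k\<close>: a call of \<open>try_satisfy\<close> has just returned \<open>b\<close> to the remaining calls \<open>st\<close>,
    or to the main loop if \<open>st\<close> is empty.
  \<^item> \<open>Halt v\<close>: CDLSC has returned \<open>v\<close>.
\<close>

datatype verdict = SAT | UNSAT

type_synonym 'a stack = "('a state \<times> nat) list"

datatype 'a config =
    Start
  | Loop "'a stack" "'a frames" nat
  | Return bool "'a stack" "'a frames" nat
  | Halt verdict

definition add_core :: "'a frames \<Rightarrow> nat \<Rightarrow> 'a state \<Rightarrow> 'a frames" where
  "add_core C i c = C(i := insert c (C i))"

inductive cdlsc_step :: "'a ltlf \<Rightarrow> 'a config \<Rightarrow> 'a config \<Rightarrow> bool" for \<phi> where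
  start_sat:
    "final {\<phi>} \<Longrightarrow> cdlsc_step \<phi> Start (Halt SAT)"
| start_loop:
    "\<not> final {\<phi>} \<Longrightarrow>
     cdlsc_step \<phi> Start (Loop [({\<phi>}, 0)] ((\<lambda>_. {})(0 := {{\<phi>}})) 0)"
| final_found:
    "A \<in> pmodels (step_query (C 0) s) \<Longrightarrow> final (next_state A) \<Longrightarrow>
     cdlsc_step \<phi> (Loop ((s, 0) # st) C k) (Return True st C k)"
| not_final:
    "A \<in> pmodels (step_query (C 0) s) \<Longrightarrow> \<not> final (next_state A) \<Longrightarrow>
     unsat_core (next_state A) Tail c \<Longrightarrow>
     cdlsc_step \<phi> (Loop ((s, 0) # st) C k) (Loop ((s, 0) # st) (add_core C 0 c) k)"
| recursive_call:
    "A \<in> pmodels (step_query (C (Suc l)) s) \<Longrightarrow>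
     cdlsc_step \<phi> (Loop ((s, Suc l) # st) C k) (Loop ((next_state A, l) # (s, Suc l) # st) C k)"
| loop_exit:
    "\<not> psat (step_query (C l) s) \<Longrightarrow> unsat_core s (not_next_frame (C l)) c \<Longrightarrow>
     cdlsc_step \<phi> (Loop ((s, l) # st) C k) (Return False st (add_core C (Suc l) c) k)"
| return_true:
    "cdlsc_step \<phi> (Return True (x # st) C k) (Return True st C k)"
| return_false:
    "cdlsc_step \<phi> (Return False (x # st) C k) (Loop (x # st) C k)"
| main_sat:
    "cdlsc_step \<phi> (Return True [] C k) (Halt SAT)"
| main_unsat:
    "inv_found C k \<Longrightarrow> cdlsc_step \<phi> (Return False [] C k) (Halt UNSAT)"
| main_continue:
    "\<not> inv_found C k \<Longrightarrow>
     cdlsc_step \<phi> (Return False [] C k) (Loop [({\<phi>}, Suc k)] (C(Suc k := {})) (Suc k))"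

text \<open>
  Termination is required for every choice of models and cores, and no run gets stuck before
  returning a verdict.
\<close>

definition cdlsc_terminates :: "'a ltlf \<Rightarrow> bool" where
  "cdlsc_terminates \<phi> \<longleftrightarrow>
     (\<nexists>run. run 0 = Start \<and> (\<forall>n::nat. cdlsc_step \<phi> (run n) (run (Suc n)))) \<and>
     (\<forall>c. (cdlsc_step \<phi>)\<^sup>*\<^sup>* Start c \<and> (\<nexists>c'. cdlsc_step \<phi> c c') \<longrightarrow> (\<exists>v. c = Halt v))"

definition cdlsc_returns :: "'a ltlf \<Rightarrow> verdict \<Rightarrow> bool" where
  "cdlsc_returns \<phi> v \<longleftrightarrow> (cdlsc_step \<phi>)\<^sup>*\<^sup>* Start (Halt v)"

end

(*
  A core c in C[i + 1] certifies that every successor of a state containing c lies in C[i], and a core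
  in C[0] that no state containing it is final. This survives the resetting of C[k + 1] between two
  rounds, because no frame above k + 1 has been filled by then. The frames need not contain {phi}
  itself, but when round j ends without a model, all successors of {phi} lie in C[j], and they remain
  there. If the intersection of C[0], ..., C[i] is contained in C[i + 1], then it is closed under
  successors, hence no final state is reachable from {phi}. Applied to the states
  {chi. chi holds at position i} of a model of phi this gives a contradiction.

  For termination, all states consist of formulas from a finite closure of phi. Within a round every
  finished call adds a new core to a frame. Over the rounds, the intersections of C[0], ..., C[i]
  decrease strictly with i as long as no invariant is found, which bounds the number of rounds.
*)

theory Submission
  imports Defs
begin

section \<open>Propositional abstraction of states and queries\<close>

text \<open>Phrased formula by formula, so that it also makes sense for the infinite states read off
  a trace; \<open>BigAnd\<close> of an infinite set is unspecified.\<close>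

definition models :: "'a ltlf set \<Rightarrow> 'a state \<Rightarrow> bool" where
  "models A s \<longleftrightarrow> (\<forall>\<chi>\<in>s. peval A (pabs (xnf \<chi>)))"

lemma models_mono: "models A s \<Longrightarrow> c \<subseteq> s \<Longrightarrow> models A c"
  unfolding models_def by blast

lemma in_frame_mono: "in_frame s F \<Longrightarrow> s \<subseteq> t \<Longrightarrow> F \<subseteq> G \<Longrightarrow> in_frame t G"
  unfolding in_frame_def by blast

lemma finite_list_choice:
  assumes "finite S"
  shows "set (SOME xs. distinct xs \<and> set xs = S) = S"
proof -
  have "\<exists>xs. distinct xs \<and> set xs = S"
    using finite_distinct_list[OF assms] by blast
  from someI_ex[OF this] show ?thesis by blast
qed

lemma peval_BigAnd:
  assumes "finite S"
  shows "peval A (pabs (BigAnd S)) \<longleftrightarrow> (\<forall>\<chi>\<in>S. peval A (pabs \<chi>))"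
proof -
  have "peval A (pabs (foldr And xs TT)) \<longleftrightarrow> (\<forall>\<chi>\<in>set xs. peval A (pabs \<chi>))" for xs
    by (induction xs) auto
  then show ?thesis
    unfolding BigAnd_def by (simp add: finite_list_choice[OF assms])
qed

lemma peval_BigOr:
  assumes "finite S"
  shows "peval A (pabs (BigOr S)) \<longleftrightarrow> (\<exists>\<chi>\<in>S. peval A (pabs \<chi>))"
proof -
  have "peval A (pabs (foldr Or xs FF)) \<longleftrightarrow> (\<exists>\<chi>\<in>set xs. peval A (pabs \<chi>))" for xs
    by (induction xs) auto
  then show ?thesis
    unfolding BigOr_def by (simp add: finite_list_choice[OF assms])
qed

lemma pvars_BigAnd:
  fixes S :: "'a ltlf set"
  assumes "finite S"
  shows "pvars (pabs (BigAnd S)) = (\<Union>\<chi>\<in>S. pvars (pabs \<chi>))"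
proof -
  have "pvars (pabs (foldr And xs TT)) = (\<Union>\<chi>\<in>set xs. pvars (pabs \<chi>))" for xs :: "'a ltlf list"
    by (induction xs) auto
  then show ?thesis
    unfolding BigAnd_def by (simp add: finite_list_choice[OF assms])
qed

lemma pvars_BigOr:
  fixes S :: "'a ltlf set"
  assumes "finite S"
  shows "pvars (pabs (BigOr S)) = (\<Union>\<chi>\<in>S. pvars (pabs \<chi>))"
proof -
  have "pvars (pabs (foldr Or xs FF)) = (\<Union>\<chi>\<in>set xs. pvars (pabs \<chi>))" for xs :: "'a ltlf list"
    by (induction xs) auto
  then show ?thesis
    unfolding BigOr_def by (simp add: finite_list_choice[OF assms])
qed

lemma peval_xnf_state: "finite s \<Longrightarrow> peval A (pabs (xnf_state s)) \<longleftrightarrow> models A s"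
  by (simp add: xnf_state_def models_def peval_BigAnd)

lemma final_iff: "finite s \<Longrightarrow> final s \<longleftrightarrow> (\<exists>A. Tail \<in> A \<and> models A s)"
  by (simp add: final_def psat_def peval_xnf_state)

text \<open>The conjunction belonging to a core \<open>c\<close> is true under \<open>A\<close> iff
  \<open>c \<subseteq> next_state A\<close>, so the query blocks exactly the successors lying in the
  frame.\<close>

lemma peval_not_next_frame:
  assumes "finite F" "\<And>c. c \<in> F \<Longrightarrow> finite c"
  shows "peval A (pabs (not_next_frame F)) \<longleftrightarrow> \<not> in_frame (next_state A) F"
  using assms
  by (auto simp: not_next_frame_def peval_BigOr peval_BigAnd in_frame_def next_state_def)

lemma peval_step_query:
  assumes "finite F" "\<And>c. c \<in> F \<Longrightarrow> finite c" "finite s"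
  shows "peval A (step_query F s) \<longleftrightarrow> \<not> in_frame (next_state A) F \<and> models A s"
  using assms by (simp add: step_query_def peval_not_next_frame peval_xnf_state)

lemma peval_Int_pvars: "peval (A \<inter> pvars f) f = peval A f"
proof -
  \<comment> \<open>The bound is a superset \<open>V\<close> of the variables because a binary
    connective needs the same restriction for both arguments.\<close>
  have "pvars f \<subseteq> V \<Longrightarrow> peval (A \<inter> V) f = peval A f" for V
    by (induction f) auto
  then show ?thesis by blast
qed

text \<open>A satisfying assignment stays satisfying when cut down to the variables of the
  query.\<close>

lemma pmodels_nonempty_iff: "(\<exists>A. A \<in> pmodels f) \<longleftrightarrow> psat f"
  unfolding pmodels_def psat_def
  by (metis (mono_tags, lifting) Int_lower2 mem_Collect_eq peval_Int_pvars)

section \<open>A finite closure containing all states of the search\<close>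

primrec subforms :: "'a ltlf \<Rightarrow> 'a ltlf set" where
  "subforms TT = {TT}"
| "subforms FF = {FF}"
| "subforms Tail = {Tail}"
| "subforms (Atom p) = {Atom p}"
| "subforms (Neg \<phi>) = insert (Neg \<phi>) (subforms \<phi>)"
| "subforms (And \<phi> \<psi>) = insert (And \<phi> \<psi>) (subforms \<phi> \<union> subforms \<psi>)"
| "subforms (Or \<phi> \<psi>) = insert (Or \<phi> \<psi>) (subforms \<phi> \<union> subforms \<psi>)"
| "subforms (Next \<phi>) = insert (Next \<phi>) (subforms \<phi>)"
| "subforms (WNext \<phi>) = insert (WNext \<phi>) (subforms \<phi>)"
| "subforms (Until \<phi> \<psi>) = insert (Until \<phi> \<psi>) (subforms \<phi> \<union> subforms \<psi>)"
| "subforms (Release \<phi> \<psi>) = insert (Release \<phi> \<psi>) (subforms \<phi> \<union> subforms \<psi>)"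

text \<open>One layer of \<open>Neg\<close> on top of the subformulas is enough, since
  \<open>xnf\<close> strips double negations before it reaches a \<open>Next\<close>.\<close>

definition closure :: "'a ltlf \<Rightarrow> 'a ltlf set" where
  "closure \<phi> = subforms \<phi> \<union> Neg ` subforms \<phi>"

lemma finite_closure: "finite (closure \<phi>)"
proof -
  have "finite (subforms \<phi>)" by (induction \<phi>) auto
  then show ?thesis by (simp add: closure_def)
qed

lemma subforms_refl: "\<phi> \<in> subforms \<phi>"
  by (cases \<phi>) auto

lemma subforms_trans: "\<chi> \<in> subforms \<phi> \<Longrightarrow> subforms \<chi> \<subseteq> subforms \<phi>"
  by (induction \<phi>) auto

text \<open>Every recursive call of \<open>xnf\<close> is on a subformula or on the negation of one;
  the disjunction in the first assumption carries both cases through the induction.\<close>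

lemma xnf_next_in_closed_set:
  assumes "subforms \<chi> \<subseteq> \<Phi> \<or> (\<exists>\<chi>'. \<chi> = Neg \<chi>' \<and> subforms \<chi>' \<subseteq> \<Phi>)"
    and "Next \<theta> \<in> pvars (pabs (xnf \<chi>))"
  shows "\<theta> \<in> \<Phi> \<union> Neg ` \<Phi>"
  using assms
  by (induction \<chi> rule: xnf.induct) (auto intro: subsetD[OF _ subforms_refl])

lemma closure_next:
  assumes "\<chi> \<in> closure \<phi>" "Next \<theta> \<in> pvars (pabs (xnf \<chi>))"
  shows "\<theta> \<in> closure \<phi>"
  unfolding closure_def
  by (rule xnf_next_in_closed_set[OF _ assms(2)])
    (use assms(1) subforms_trans in \<open>auto simp: closure_def\<close>)

text \<open>A model assigns only variables of the query, so each \<open>Next\<close> in it stems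
  from a core of \<open>F\<close> or from the normal form of a member of \<open>s\<close>. This
  keeps the search inside a finite state space.\<close>

lemma next_state_subset_closure:
  assumes A: "A \<in> pmodels (step_query F s)"
    and F: "F \<subseteq> Pow (closure \<phi>)" and s: "s \<subseteq> closure \<phi>"
  shows "next_state A \<subseteq> closure \<phi>"
proof
  fix \<theta> assume "\<theta> \<in> next_state A"
  with A have v: "Next \<theta> \<in> pvars (step_query F s)"
    by (auto simp: next_state_def pmodels_def)
  have fin: "finite F" "finite s" "\<And>c. c \<in> F \<Longrightarrow> finite c"
    using F s finite_closure[of \<phi>] by (auto intro: finite_subset)
  show "\<theta> \<in> closure \<phi>"
    using v fin F s closure_next[of _ \<phi> \<theta>]
    by (auto simp: step_query_def not_next_frame_def xnf_state_def pvars_BigAnd pvars_BigOr)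
qed


section \<open>Soundness of the transition relation between states\<close>

definition state_sat :: "'a state \<Rightarrow> bool" where
  "state_sat s \<longleftrightarrow> (\<exists>\<rho>. \<rho> \<noteq> [] \<and> (\<forall>\<chi>\<in>s. holds \<rho> 0 \<chi>))"

lemma state_sat_singleton: "state_sat {\<phi>} \<longleftrightarrow> satisfiable \<phi>"
  by (simp add: state_sat_def satisfiable_def)

lemma holds_Cons: "holds (a # \<rho>) (Suc i) \<chi> \<longleftrightarrow> holds \<rho> i \<chi>"
proof (induction \<chi> arbitrary: i)
  case (Until \<alpha> \<beta>)
  have "(\<exists>j\<ge>Suc i. P j) \<longleftrightarrow> (\<exists>j\<ge>i. P (Suc j))" for P
    by (metis Suc_le_D Suc_le_mono)
  moreover have "(\<forall>m. Suc i \<le> m \<and> m < Suc j \<longrightarrow> P m) \<longleftrightarrow> (\<forall>m. i \<le> m \<and> m < j \<longrightarrow> P (Suc m))" for P j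
    by (metis Suc_le_D Suc_le_mono not_less_eq)
  ultimately show ?case using Until by simp
next
  case (Release \<alpha> \<beta>)
  have "(\<forall>j. Suc i \<le> j \<and> j < Suc n \<longrightarrow> P j) \<longleftrightarrow> (\<forall>j. i \<le> j \<and> j < n \<longrightarrow> P (Suc j))" for P n
    by (metis Suc_le_D Suc_le_mono not_less_eq)
  moreover have "(\<exists>m\<ge>Suc i. P m) \<longleftrightarrow> (\<exists>m\<ge>i. P (Suc m))" for P
    by (metis Suc_le_D Suc_le_mono)
  ultimately show ?case using Release by simp
qed auto

text \<open>For \<open>Next\<close> an implication is enough, because \<open>Next\<close> occurs
  only positively in the normal form. It is asked for only when \<open>Tail\<close> is false:
  otherwise the \<open>Tail\<close> guards decide every occurrence of \<open>Next\<close>.\<close>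

lemma peval_imp_holds:
  assumes "\<rho> \<noteq> []" and "\<And>p. Atom p \<in> A \<longleftrightarrow> p \<in> \<rho> ! 0"
    and "Tail \<in> A \<longleftrightarrow> Suc 0 = length \<rho>"
    and "\<And>\<theta>. Tail \<notin> A \<Longrightarrow> Next \<theta> \<in> A \<Longrightarrow> holds \<rho> (Suc 0) \<theta>"
    and "peval A (pabs (xnf \<chi>))"
  shows "holds \<rho> 0 \<chi>"
proof -
  have len: "0 < length \<rho>" using assms(1) by simp
  have succ: "Tail \<in> A \<or> holds \<rho> (Suc 0) \<theta>" if "Next \<theta> \<in> A" for \<theta>
    using assms(4) that by blast
  have "holds \<rho> 0 (xnf \<chi>)"
    using assms(5)
    by (induction \<chi> rule: xnf.induct)
      (use len assms(2,3) in \<open>auto simp del: holds.simps(10,11) simp: Suc_lessI dest!: succ\<close>)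
  then show ?thesis using holds_xnf[OF len] by blast
qed

lemma state_sat_if_final:
  assumes "Tail \<in> A" "models A s"
  shows "state_sat s"
proof -
  let ?\<rho> = "[{p. Atom p \<in> A}]"
  have "holds ?\<rho> 0 \<chi>" if "\<chi> \<in> s" for \<chi>
    by (rule peval_imp_holds[of _ A]) (use assms that in \<open>auto simp: models_def\<close>)
  then show ?thesis unfolding state_sat_def by blast
qed

text \<open>
  An assignment may make \<open>Tail\<close> true although the search continues with its next state; in that case
  \<open>s\<close> is already final.
\<close>

lemma state_sat_if_next:
  assumes "models A s" "state_sat (next_state A)"
  shows "state_sat s"
proof (cases "Tail \<in> A")
  case False
  obtain \<rho> where \<rho>: "\<rho> \<noteq> []" "\<And>\<chi>. Next \<chi> \<in> A \<Longrightarrow> holds \<rho> 0 \<chi>"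
    using assms(2) by (auto simp: state_sat_def next_state_def)
  let ?\<rho> = "{p. Atom p \<in> A} # \<rho>"
  have "holds ?\<rho> 0 \<chi>" if "\<chi> \<in> s" for \<chi>
    by (rule peval_imp_holds[of _ A])
      (use assms(1) that \<rho> False in \<open>auto simp: models_def holds_Cons\<close>)
  then show ?thesis unfolding state_sat_def by blast
qed (use assms(1) state_sat_if_final in blast)

section \<open>Traces as runs of states\<close>

lemma peval_holds: "peval {v. holds \<rho> i v} (pabs \<theta>) \<longleftrightarrow> holds \<rho> i \<theta>"
  by (induction \<theta>) (auto simp del: holds.simps(8-11))

text \<open>The set of all formulas true at a position serves at once as an assignment and as a
  state, so a trace becomes a run of the transition relation.\<close>

lemma models_holds:
  assumes "i < length \<rho>"
  shows "models {v. holds \<rho> i v} {v. holds \<rho> i v}"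
  using assms by (simp add: models_def peval_holds holds_xnf)

lemma next_state_holds:
  assumes "Suc i < length \<rho>"
  shows "next_state {v. holds \<rho> i v} = {v. holds \<rho> (Suc i) v}"
  using assms by (simp add: next_state_def)


section \<open>The invariant\<close>

text \<open>All assignments count, not just those in \<open>pmodels\<close>, so that the ones read
  off a trace are covered.\<close>

definition leads_into :: "'a state \<Rightarrow> 'a state set \<Rightarrow> bool" where
  "leads_into s F \<longleftrightarrow> (\<forall>A. models A s \<longrightarrow> in_frame (next_state A) F)"

lemma leads_into_mono: "leads_into s F \<Longrightarrow> F \<subseteq> G \<Longrightarrow> leads_into s G"
  unfolding leads_into_def using in_frame_mono by blast

text \<open>The last clause stops below \<open>k\<close>: that all successors of
  \<open>{\<phi>}\<close> lie in \<open>C k\<close> is known only once the outermost call of the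
  round has left its loop.\<close>

definition frames_ok :: "'a ltlf \<Rightarrow> 'a frames \<Rightarrow> nat \<Rightarrow> bool" where
  "frames_ok \<phi> C k \<longleftrightarrow>
     \<not> final {\<phi>} \<and>
     (\<forall>i. C i \<subseteq> Pow (closure \<phi>)) \<and>
     (\<forall>c\<in>C 0. \<not> final c) \<and>
     (\<forall>i. \<forall>c\<in>C (Suc i). leads_into c (C i)) \<and>
     (\<forall>i>Suc k. C i = {}) \<and>
     (\<forall>j<k. leads_into {\<phi>} (C j))"

text \<open>A call at level \<open>l < k\<close> was started on a successor chosen outside
  \<open>C (Suc l)\<close>, and calls nested in it add cores only at levels up to \<open>l\<close>.
  Hence the core added when it exits is new, which termination relies on.\<close>

definition stack_ok :: "'a ltlf \<Rightarrow> 'a frames \<Rightarrow> nat \<Rightarrow> 'a stack \<Rightarrow> bool" where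
  "stack_ok \<phi> C k st \<longleftrightarrow>
     sorted_wrt (<) (map snd st) \<and>
     (st \<noteq> [] \<longrightarrow> last st = ({\<phi>}, k)) \<and>
     (\<forall>(s, l)\<in>set st. s \<subseteq> closure \<phi> \<and> (state_sat s \<longrightarrow> satisfiable \<phi>) \<and>
        (l < k \<longrightarrow> \<not> in_frame s (C (Suc l))))"

text \<open>After \<open>Return True\<close> the calls are merely unwound, so satisfiability is all
  that must be remembered. An empty stack after \<open>Return False\<close> marks the end of a
  round, when \<open>C k\<close> has caught all successors of \<open>{\<phi>}\<close>.\<close>

primrec config_ok :: "'a ltlf \<Rightarrow> 'a config \<Rightarrow> bool" where
  "config_ok \<phi> Start \<longleftrightarrow> True"
| "config_ok \<phi> (Loop st C k) \<longleftrightarrow> frames_ok \<phi> C k \<and> stack_ok \<phi> C k st \<and> st \<noteq> []"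
| "config_ok \<phi> (Return b st C k) \<longleftrightarrow>
     (if b then satisfiable \<phi>
      else frames_ok \<phi> C k \<and> stack_ok \<phi> C k st \<and> (st = [] \<longrightarrow> leads_into {\<phi>} (C k)))"
| "config_ok \<phi> (Halt v) \<longleftrightarrow> (v = SAT \<longleftrightarrow> satisfiable \<phi>)"

lemma frames_ok_finite:
  assumes "frames_ok \<phi> C k"
  shows "finite (C i)" "c \<in> C i \<Longrightarrow> finite c"
proof -
  have "C i \<subseteq> Pow (closure \<phi>)" using assms by (auto simp: frames_ok_def)
  then show "finite (C i)" "c \<in> C i \<Longrightarrow> finite c"
    using finite_closure[of \<phi>] by (auto intro: finite_subset)
qed

lemma stack_ok_Cons:
  "stack_ok \<phi> C k ((s, l) # st) \<longleftrightarrow>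
     stack_ok \<phi> C k st \<and> (\<forall>(t, m)\<in>set st. l < m) \<and>
     (if st = [] then s = {\<phi>} \<and> l = k else l < k) \<and>
     s \<subseteq> closure \<phi> \<and> (state_sat s \<longrightarrow> satisfiable \<phi>) \<and> (l < k \<longrightarrow> \<not> in_frame s (C (Suc l)))"
proof (cases "st = []")
  case False
  then have "l < k" if "\<forall>(t, m)\<in>set st. l < m" "last st = ({\<phi>}, k)"
    using that last_in_set by fastforce
  with False show ?thesis unfolding stack_ok_def by (auto simp: case_prod_unfold)
qed (auto simp: stack_ok_def)

text \<open>A pending call at level \<open>m\<close> constrains only \<open>C (Suc m)\<close>, which
  lies above the level \<open>i\<close> being extended.\<close>

lemma stack_ok_add_core:
  assumes "stack_ok \<phi> C k st" and "\<forall>(t, m)\<in>set st. i \<le> m"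
  shows "stack_ok \<phi> (add_core C i c) k st"
proof -
  have "add_core C i c (Suc m) = C (Suc m)" if "(t, m) \<in> set st" for t m
    using assms(2) that by (auto simp: add_core_def)
  with assms(1) show ?thesis unfolding stack_ok_def by fastforce
qed

text \<open>Enlarging a frame preserves every claim of leading into it, so only the new core needs a
  certificate.\<close>

lemma frames_ok_add_core:
  assumes "frames_ok \<phi> C k" "c \<subseteq> closure \<phi>" "i \<le> Suc k"
    and "case i of 0 \<Rightarrow> \<not> final c | Suc l \<Rightarrow> leads_into c (C l)"
  shows "frames_ok \<phi> (add_core C i c) k"
proof -
  have mem: "d \<in> add_core C i c j \<longleftrightarrow> d \<in> C j \<or> j = i \<and> d = c" for d j
    by (auto simp: add_core_def)
  have leads: "leads_into s (add_core C i c j)" if "leads_into s (C j)" for s j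
    using that by (rule leads_into_mono) (auto simp: mem)
  have "leads_into d (add_core C i c j)" if "d \<in> add_core C i c (Suc j)" for d j
    using that assms(1,4) leads by (auto simp: mem frames_ok_def)
  moreover have "add_core C i c j = {}" if "j > Suc k" for j
    using that assms(1,3) by (auto simp: frames_ok_def add_core_def)
  moreover have "add_core C i c j \<subseteq> Pow (closure \<phi>)" for j
  proof -
    have "C j \<subseteq> Pow (closure \<phi>)" using assms(1) by (simp add: frames_ok_def)
    then show ?thesis using assms(2) unfolding add_core_def by (cases "j = i") auto
  qed
  moreover have "\<forall>d\<in>add_core C i c 0. \<not> final d"
    using assms(1,4) by (auto simp: mem frames_ok_def)
  ultimately show ?thesis
    using assms(1) leads by (simp add: frames_ok_def)
qed

text \<open>
  \<^const>\<open>inv_found\<close> speaks about finite states only, whereas the states read off a trace are infinite;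
  the union of the cores witnessing membership is a finite substitute.
\<close>

lemma inv_found_holds:
  assumes "\<forall>s. finite s \<longrightarrow> (\<forall>j\<le>i. in_frame s (C j)) \<longrightarrow> in_frame s (C (Suc i))"
    and fin: "\<And>j c. c \<in> C j \<Longrightarrow> finite c"
    and s: "\<forall>j\<le>i. in_frame s (C j)"
  shows "in_frame s (C (Suc i))"
proof -
  from s obtain f where f: "\<And>j. j \<le> i \<Longrightarrow> f j \<in> C j \<and> f j \<subseteq> s"
    unfolding in_frame_def by metis
  let ?t = "\<Union>j\<le>i. f j"
  have "finite ?t" using f fin by blast
  moreover have "\<forall>j\<le>i. in_frame ?t (C j)" using f unfolding in_frame_def by blast
  ultimately have "in_frame ?t (C (Suc i))" using assms(1) by blast
  then show ?thesis by (rule in_frame_mono) (use f in auto)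
qed

lemma inv_found_imp_unsatisfiable:
  assumes ok: "frames_ok \<phi> C k" and lk: "leads_into {\<phi>} (C k)" and inv: "inv_found C k"
  shows "\<not> satisfiable \<phi>"
proof
  assume "satisfiable \<phi>"
  then obtain \<rho> where \<rho>: "\<rho> \<noteq> []" "holds \<rho> 0 \<phi>" by (auto simp: satisfiable_def)
  let ?V = "\<lambda>n. {v. holds \<rho> n v}"
  from inv obtain i where i: "i \<le> k"
    and closed: "\<forall>s. finite s \<longrightarrow> (\<forall>j\<le>i. in_frame s (C j)) \<longrightarrow> in_frame s (C (Suc i))"
    by (auto simp: inv_found_def)
  \<comment> \<open>Levels below \<open>k\<close> come from earlier rounds, level \<open>k\<close>
    from the round just ended.\<close>
  have start: "leads_into {\<phi>} (C j)" if "j \<le> i" for j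
    using ok lk i that by (cases "j = k") (auto simp: frames_ok_def)
  have step: "in_frame (next_state A) (C j)" if s: "in_frame s (C (Suc j))" and A: "models A s" for A s j
  proof -
    obtain c where "c \<in> C (Suc j)" "c \<subseteq> s" using s by (auto simp: in_frame_def)
    moreover from this have "models A c" using A models_mono by blast
    ultimately show ?thesis using ok unfolding frames_ok_def leads_into_def by blast
  qed
  \<comment> \<open>The induction starts at position 1, since the first state need not lie in any
    frame.\<close>
  have reach: "\<forall>j\<le>i. in_frame (?V (Suc n)) (C j)" if "Suc n < length \<rho>" for n
    using that
  proof (induction n)
    case 0
    have "models (?V 0) {\<phi>}"
      using models_holds[of 0 \<rho>] \<rho> by (auto intro: models_mono)
    then have "in_frame (next_state (?V 0)) (C j)" if "j \<le> i" for j
      using start that by (auto simp: leads_into_def)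
    then show ?case using next_state_holds[OF 0] by simp
  next
    case (Suc n)
    then have IH: "\<forall>j\<le>i. in_frame (?V (Suc n)) (C j)" by simp
    \<comment> \<open>Closure supplies level \<open>Suc i\<close>. A transition lowers the levels 1
      to \<open>Suc i\<close> by one and so gives back the levels 0 to \<open>i\<close>.\<close>
    have "in_frame (?V (Suc n)) (C (Suc i))"
      by (rule inv_found_holds[OF closed _ IH]) (use frames_ok_finite[OF ok] in blast)
    with IH have "in_frame (?V (Suc n)) (C (Suc j))" if "j \<le> i" for j
      using that by (cases "j = i") auto
    then have "in_frame (next_state (?V (Suc n))) (C j)" if "j \<le> i" for j
      using Suc.prems that by (intro step[OF _ models_holds]) auto
    then show ?case using next_state_holds[OF Suc.prems] by simp
  qed
  define n where "n = length \<rho> - 1"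
  have n: "Suc n = length \<rho>" using \<rho> by (simp add: n_def)
  then have mod: "models (?V n) (?V n)" "Tail \<in> ?V n" by (auto intro: models_holds)
  show False
  \<comment> \<open>On a trace of length one the only state makes \<open>{\<phi>}\<close> final; on
    a longer one the last state lies in \<open>C 0\<close>, whose cores are not final.\<close>
  proof (cases n)
    case 0
    then have "models (?V n) {\<phi>}" using mod \<rho> by (auto intro: models_mono)
    with mod have "final {\<phi>}" unfolding final_iff[of "{\<phi>}", simplified] by blast
    then show False using ok by (simp add: frames_ok_def)
  next
    case (Suc m)
    with reach[of m] n have "in_frame (?V n) (C 0)" by auto
    then obtain c where c: "c \<in> C 0" "c \<subseteq> ?V n" by (auto simp: in_frame_def)
    with mod have "final c"
      using final_iff frames_ok_finite(2)[OF ok] models_mono by metis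
    then show False using ok c by (auto simp: frames_ok_def)
  qed
qed

section \<open>Preservation of the invariant and progress\<close>

lemma frames_ok_start:
  assumes "\<not> final {\<phi>}"
  shows "frames_ok \<phi> ((\<lambda>_. {})(0 := {{\<phi>}})) 0"
  using assms subforms_refl[of \<phi>] by (simp add: frames_ok_def closure_def)

lemma frames_ok_next_round:
  assumes "frames_ok \<phi> C k" "leads_into {\<phi>} (C k)"
  shows "frames_ok \<phi> (C(Suc k := {})) (Suc k)"
  using assms by (auto simp: frames_ok_def less_Suc_eq)

lemma stack_ok_singleton: "stack_ok \<phi> C k [({\<phi>}, k)]"
  using subforms_refl[of \<phi>] by (auto simp: stack_ok_def state_sat_singleton closure_def)

lemma query_model:
  assumes "frames_ok \<phi> C k" "stack_ok \<phi> C k ((s, l) # st)" "A \<in> pmodels (step_query (C i) s)"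
  shows "models A s" "\<not> in_frame (next_state A) (C i)" "next_state A \<subseteq> closure \<phi>"
    "state_sat (next_state A) \<Longrightarrow> satisfiable \<phi>"
proof -
  have s: "s \<subseteq> closure \<phi>" "state_sat s \<Longrightarrow> satisfiable \<phi>"
    using assms(2) by (auto simp: stack_ok_Cons)
  then have "finite s" using finite_closure finite_subset by blast
  with assms(3) show A: "models A s" "\<not> in_frame (next_state A) (C i)"
    using peval_step_query[OF frames_ok_finite[OF assms(1)]] by (auto simp: pmodels_def)
  show "next_state A \<subseteq> closure \<phi>"
    using assms(1) s by (intro next_state_subset_closure[OF assms(3)]) (auto simp: frames_ok_def)
  show "state_sat (next_state A) \<Longrightarrow> satisfiable \<phi>"
    using s state_sat_if_next A by blast
qed

text \<open>Unsatisfiability of the query for \<open>c\<close> says that no model of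
  \<open>c\<close> has a next state outside the frame.\<close>

lemma core_leads_into:
  assumes "frames_ok \<phi> C k" "s \<subseteq> closure \<phi>" "unsat_core s (not_next_frame (C l)) c"
  shows "leads_into c (C l)"
proof -
  have "finite c"
    using assms(2,3) finite_closure[of \<phi>] by (auto simp: unsat_core_def intro: finite_subset)
  have "peval A (pabs (not_next_frame (C l))) \<longleftrightarrow> \<not> in_frame (next_state A) (C l)" for A
    using frames_ok_finite[OF assms(1)] by (rule peval_not_next_frame)
  then show ?thesis
    using assms(3) \<open>finite c\<close>
    by (auto simp: leads_into_def unsat_core_def psat_def peval_xnf_state)
qed

lemma core_not_final:
  assumes "finite s" "unsat_core s Tail c"
  shows "\<not> final c"
  using assms by (auto simp: unsat_core_def final_def psat_def)

lemma config_ok_step: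
  assumes "cdlsc_step \<phi> x y" "config_ok \<phi> x"
  shows "config_ok \<phi> y"
  using assms
proof cases
  case start_sat
  then show ?thesis
    using state_sat_if_final by (auto simp: final_iff state_sat_singleton[symmetric])
next
  case start_loop
  then show ?thesis using frames_ok_start stack_ok_singleton by auto
next
  case (final_found A C s st k)
  then have ok: "frames_ok \<phi> C k" "stack_ok \<phi> C k ((s, 0) # st)" using assms by auto
  note q = query_model[OF ok final_found(3)]
  have "finite (next_state A)" using q(3) finite_closure finite_subset by blast
  then have "state_sat (next_state A)"
    using final_found final_iff state_sat_if_final by blast
  with q show ?thesis using final_found by auto
next
  case (not_final A C s c st k)
  then have ok: "frames_ok \<phi> C k" "stack_ok \<phi> C k ((s, 0) # st)" using assms by auto
  note q = query_model[OF ok not_final(3)]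
  have "finite (next_state A)" using q(3) finite_closure finite_subset by blast
  then have "\<not> final c" "c \<subseteq> closure \<phi>"
    using not_final q(3) core_not_final by (auto simp: unsat_core_def)
  then show ?thesis
    using not_final ok by (auto intro!: frames_ok_add_core stack_ok_add_core)
next
  case (recursive_call A C l s st k)
  then have ok: "frames_ok \<phi> C k" "stack_ok \<phi> C k ((s, Suc l) # st)" using assms by auto
  note q = query_model[OF ok recursive_call(3)]
  have "stack_ok \<phi> C k ((next_state A, l) # (s, Suc l) # st)"
    using ok(2) q by (auto simp: stack_ok_Cons split: if_splits)
  then show ?thesis using recursive_call ok by simp
next
  case (loop_exit C l s c st k)
  then have ok: "frames_ok \<phi> C k" "stack_ok \<phi> C k ((s, l) # st)" using assms by auto
  have s: "s \<subseteq> closure \<phi>" "l \<le> k" using ok by (auto simp: stack_ok_Cons split: if_splits)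
  have c: "leads_into c (C l)" "c \<subseteq> closure \<phi>"
    using core_leads_into[OF ok(1) s(1) loop_exit(4)] loop_exit(4) s by (auto simp: unsat_core_def)
  have "frames_ok \<phi> (add_core C (Suc l) c) k"
    using ok c s by (intro frames_ok_add_core) auto
  moreover have "stack_ok \<phi> (add_core C (Suc l) c) k st"
    using ok(2) by (intro stack_ok_add_core) (auto simp: stack_ok_Cons)
  moreover have "leads_into {\<phi>} (add_core C (Suc l) c k)" if "st = []"
  proof -
    have "s = {\<phi>}" "l = k" using ok(2) that by (auto simp: stack_ok_Cons)
    \<comment> \<open>The core actually returned may be smaller, but the full state is a core as
      well; this yields the claim for \<open>{\<phi>}\<close> itself. The new core goes to
      \<open>C (Suc k)\<close> and leaves \<open>C k\<close> unchanged.\<close>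
    moreover have "unsat_core s (not_next_frame (C l)) s"
      using loop_exit by (auto simp: unsat_core_def step_query_def psat_def)
    ultimately show ?thesis
      using core_leads_into[OF ok(1) s(1)] by (simp add: add_core_def)
  qed
  ultimately show ?thesis using loop_exit by simp
next
  case (main_unsat C k)
  then show ?thesis using assms inv_found_imp_unsatisfiable by auto
next
  case (main_continue C k)
  then show ?thesis using assms frames_ok_next_round stack_ok_singleton by auto
qed (use assms in auto)

lemma config_ok_reachable: "(cdlsc_step \<phi>)\<^sup>*\<^sup>* Start x \<Longrightarrow> config_ok \<phi> x"
  by (induction rule: rtranclp_induct) (auto intro: config_ok_step)

lemma config_ok_progress:
  assumes "config_ok \<phi> x" "\<nexists>y. cdlsc_step \<phi> x y"
  shows "\<exists>v. x = Halt v"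
proof (cases x)
  case Start
  then show ?thesis using assms(2) start_sat start_loop by blast
next
  case (Loop st C k)
  with assms obtain s l st' where st: "st = (s, l) # st'" by (cases st) auto
  with Loop assms have ok: "frames_ok \<phi> C k" "stack_ok \<phi> C k ((s, l) # st')" by auto
  have "\<exists>y. cdlsc_step \<phi> x y"
  proof (cases "psat (step_query (C l) s)")
    case True
    then obtain A where A: "A \<in> pmodels (step_query (C l) s)"
      using pmodels_nonempty_iff by blast
    show ?thesis
    proof (cases l)
      case 0
      \<comment> \<open>\<open>get_uc\<close> always has an admissible answer, namely the whole
        state.\<close>
      have "unsat_core (next_state A) Tail (next_state A)" if "\<not> final (next_state A)"
        using that by (auto simp: unsat_core_def final_def psat_def)
      then show ?thesis using A 0 Loop st final_found not_final by blast
    next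
      case (Suc m)
      then show ?thesis using A Loop st recursive_call by blast
    qed
  next
    case False
    then have "unsat_core s (not_next_frame (C l)) s"
      by (auto simp: unsat_core_def step_query_def psat_def)
    with False show ?thesis using Loop st loop_exit by blast
  qed
  with assms(2) show ?thesis by blast
next
  case (Return b st C k)
  have "\<exists>y. cdlsc_step \<phi> (Return b st C k) y"
    by (cases b; cases st; cases "inv_found C k")
      (auto intro: main_sat return_true return_false main_unsat main_continue)
  with assms(2) Return show ?thesis by blast
qed auto


section \<open>Termination\<close>

lemma not_inv_found_bound:
  assumes ok: "frames_ok \<phi> C k" and "\<not> inv_found C k"
  shows "k < card (Pow (closure \<phi>))"
proof -
  define D where "D i = {s \<in> Pow (closure \<phi>). \<forall>j\<le>i. in_frame s (C j)}" for i
  have fin: "finite (D i)" for i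
    using finite_closure[of \<phi>] by (simp add: D_def)
  have less: "card (D (Suc i)) < card (D i)" if "i \<le> k" for i
  proof (rule psubset_card_mono[OF fin])
    from assms(2) that obtain s where s: "\<forall>j\<le>i. in_frame s (C j)" "\<not> in_frame s (C (Suc i))"
      by (auto simp: inv_found_def)
    \<comment> \<open>The witness \<open>s\<close> may contain arbitrary formulas. All cores lie in
      the closure, so intersecting \<open>s\<close> with it changes no membership in a
      frame.\<close>
    have "c \<subseteq> closure \<phi>" if "c \<in> C j" for c j
      using ok that unfolding frames_ok_def by (metis PowD subsetD)
    then have C: "in_frame (s \<inter> closure \<phi>) (C j) \<longleftrightarrow> in_frame s (C j)" for j
      by (auto simp only: in_frame_def le_inf_iff)
    have "s \<inter> closure \<phi> \<in> D i" "s \<inter> closure \<phi> \<notin> D (Suc i)"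
      using s C by (auto simp: D_def)
    moreover have "D (Suc i) \<subseteq> D i" by (auto simp: D_def)
    ultimately show "D (Suc i) \<subset> D i" by blast
  qed
  \<comment> \<open>Each of the \<open>Suc k\<close> inclusions from \<open>D 0\<close> down to
    \<open>D (Suc k)\<close> is strict and costs at least one element.\<close>
  have "i + card (D i) \<le> card (D 0)" if "i \<le> Suc k" for i
    using that
  proof (induction i)
    case (Suc i)
    then show ?case using less[of i] by simp
  qed simp
  from this[of "Suc k"] have "Suc k \<le> card (D 0)" by simp
  also have "\<dots> \<le> card (Pow (closure \<phi>))"
    using finite_closure[of \<phi>] by (intro card_mono) (auto simp: D_def)
  finally show ?thesis by simp
qed

text \<open>Counts the cores that can still enter the frames up to \<open>k\<close>. The frame
  \<open>C (Suc k)\<close> is left out: it grows only when the outermost call exits, which ends the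
  round.\<close>

definition room :: "'a ltlf \<Rightarrow> 'a frames \<Rightarrow> nat \<Rightarrow> nat" where
  "room \<phi> C k = (\<Sum>i\<le>k. card (Pow (closure \<phi>) - C i))"

lemma room_add_core:
  assumes "i \<le> k" "c \<subseteq> closure \<phi>" "c \<notin> C i"
  shows "room \<phi> (add_core C i c) k < room \<phi> C k"
  unfolding room_def
proof (rule sum_strict_mono_ex1)
  show "\<forall>j\<in>{..k}. card (Pow (closure \<phi>) - add_core C i c j) \<le> card (Pow (closure \<phi>) - C j)"
    using finite_closure[of \<phi>] by (auto simp: add_core_def intro!: card_mono)
  have "card (Pow (closure \<phi>) - add_core C i c i) < card (Pow (closure \<phi>) - C i)"
    using finite_closure[of \<phi>] assms by (intro psubset_card_mono) (auto simp: add_core_def)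
  with assms(1)
  show "\<exists>j\<in>{..k}. card (Pow (closure \<phi>) - add_core C i c j) < card (Pow (closure \<phi>) - C j)"
    by blast
qed simp

text \<open>The components are the rounds left, the phase (2 inside a search, 1 while unwinding or
  at the end of a round), the room for cores, and the level of the innermost call. The entry
  \<open>Suc k\<close> exceeds every level, so resuming a caller after \<open>Return False\<close>
  decreases the rank.\<close>

primrec rank :: "'a ltlf \<Rightarrow> 'a config \<Rightarrow> nat \<times> nat \<times> nat \<times> nat" where
  "rank \<phi> Start = (Suc (card (Pow (closure \<phi>))), 0, 0, 0)"
| "rank \<phi> (Loop st C k) = (card (Pow (closure \<phi>)) - k, 2, room \<phi> C k, snd (hd st))"
| "rank \<phi> (Return b st C k) =
     (card (Pow (closure \<phi>)) - k,
      if b \<or> st = [] then (1, 0, length st) else (2, room \<phi> C k, Suc k))"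
| "rank \<phi> (Halt v) = (0, 0, 0, 0)"

abbreviation rank_less :: "((nat \<times> nat \<times> nat \<times> nat) \<times> (nat \<times> nat \<times> nat \<times> nat)) set" where
  "rank_less \<equiv> less_than <*lex*> less_than <*lex*> less_than <*lex*> less_than"

lemma rank_step:
  assumes "cdlsc_step \<phi> x y" "config_ok \<phi> x"
  shows "(rank \<phi> y, rank \<phi> x) \<in> rank_less"
  using assms
proof cases
  case (not_final A C s c st k)
  then have ok: "frames_ok \<phi> C k" "stack_ok \<phi> C k ((s, 0) # st)" using assms by auto
  note q = query_model[OF ok not_final(3)]
  have c: "c \<subseteq> next_state A" using not_final by (simp add: unsat_core_def)
  \<comment> \<open>The model avoids the frame, so no core already in \<open>C 0\<close> is a subset
    of its next state, whereas \<open>c\<close> is.\<close>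
  with q(2) have "c \<notin> C 0" unfolding in_frame_def by blast
  then have "room \<phi> (add_core C 0 c) k < room \<phi> C k"
    using c q(3) by (intro room_add_core) auto
  then show ?thesis using not_final by simp
next
  case (loop_exit C l s c st k)
  then have ok: "stack_ok \<phi> C k ((s, l) # st)" using assms by auto
  show ?thesis
  proof (cases "st = []")
    case False
    have c: "c \<subseteq> s" using loop_exit by (simp add: unsat_core_def)
    from ok False have s: "l < k" "s \<subseteq> closure \<phi>" "\<not> in_frame s (C (Suc l))"
      by (auto simp: stack_ok_Cons)
    with c have "c \<notin> C (Suc l)" unfolding in_frame_def by blast
    then have "room \<phi> (add_core C (Suc l) c) k < room \<phi> C k"
      using c s by (intro room_add_core) auto
    then show ?thesis using loop_exit False by simp
  qed (use loop_exit in simp)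
next
  case (return_false z st C k)
  then have "stack_ok \<phi> C k (z # st)" using assms by auto
  then have "snd z \<le> k" by (cases z) (auto simp: stack_ok_Cons split: if_splits)
  then show ?thesis using return_false by simp
next
  case (main_continue C k)
  then have "k < card (Pow (closure \<phi>))" using assms not_inv_found_bound by auto
  then show ?thesis using main_continue by simp
qed (use assms in auto)

lemma wf_rank_less: "wf rank_less"
  by (intro wf_lex_prod wf_less_than)

lemma cdlsc_terminates: "cdlsc_terminates \<phi>"
  unfolding cdlsc_terminates_def
proof
  show "\<nexists>run. run 0 = Start \<and> (\<forall>n::nat. cdlsc_step \<phi> (run n) (run (Suc n)))"
  proof
    assume "\<exists>run. run 0 = Start \<and> (\<forall>n::nat. cdlsc_step \<phi> (run n) (run (Suc n)))"
    then obtain run where run: "run 0 = Start" "\<And>n::nat. cdlsc_step \<phi> (run n) (run (Suc n))"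
      by blast
    have "config_ok \<phi> (run n)" for n
    proof (induction n)
      case (Suc n)
      then show ?case using run(2) config_ok_step by blast
    qed (simp add: run(1))
    then have "\<forall>n. (rank \<phi> (run (Suc n)), rank \<phi> (run n)) \<in> rank_less"
      using rank_step run(2) by blast
    then show False
      using wf_rank_less unfolding wf_iff_no_infinite_down_chain
      by (elim notE exI[of _ "\<lambda>n. rank \<phi> (run n)"])
  qed
  show "\<forall>c. (cdlsc_step \<phi>)\<^sup>*\<^sup>* Start c \<and> (\<nexists>c'. cdlsc_step \<phi> c c') \<longrightarrow> (\<exists>v. c = Halt v)"
    using config_ok_reachable config_ok_progress by blast
qed

text \<open>Following steps of decreasing rank must end in a configuration without successor, and by
  progress this is a \<open>Halt\<close>.\<close>

lemma halt_reachable: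
  assumes "config_ok \<phi> x"
  shows "\<exists>v. (cdlsc_step \<phi>)\<^sup>*\<^sup>* x (Halt v)"
  using wf_inv_image[OF wf_rank_less, of "rank \<phi>"] assms
proof (induction x rule: wf_induct_rule)
  case (less x)
  show ?case
  proof (cases "\<exists>y. cdlsc_step \<phi> x y")
    case True
    then obtain y where y: "cdlsc_step \<phi> x y" by blast
    then have "\<exists>v. (cdlsc_step \<phi>)\<^sup>*\<^sup>* y (Halt v)"
      using less rank_step config_ok_step by (metis in_inv_image)
    with y show ?thesis by (meson converse_rtranclp_into_rtranclp)
  qed (use config_ok_progress less in blast)
qed

theorem mainTheorem4:
  fixes \<phi> :: "'a ltlf"
  shows "cdlsc_terminates \<phi> \<and>
    (satisfiable \<phi> \<longrightarrow> (\<forall>v. cdlsc_returns \<phi> v \<longleftrightarrow> v = SAT)) \<and>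
    (\<not> satisfiable \<phi> \<longrightarrow> (\<forall>v. cdlsc_returns \<phi> v \<longleftrightarrow> v = UNSAT))"
proof -
  have sound: "v = SAT \<longleftrightarrow> satisfiable \<phi>" if "cdlsc_returns \<phi> v" for v
    using that config_ok_reachable unfolding cdlsc_returns_def by fastforce
  \<comment> \<open>Some verdict is returned and every returned verdict is right, so exactly the
    right one is returned.\<close>
  moreover obtain v where "cdlsc_returns \<phi> v"
    using halt_reachable[of \<phi> Start] by (auto simp: cdlsc_returns_def)
  ultimately show ?thesis using cdlsc_terminates by (metis verdict.exhaust)
qed

end
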